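(* Fix a sampling period $T_s$ and time-invariant upper and lower bounds on acceleration and velocity, $a_{\max}$, $a_{\min}$, $v_{\max}$ and $v_{\min}$, with $a_{\min}<0<a_{\max}$. Use the following driving profile: the vehicle starts from velocity $v_{\min}$, performs $M$ repeated cycles between $v_{\min}$ and an intermediate velocity $v_1$ (in each cycle it accelerates from $v_{\min}$ to $v_1$ with constant acceleration $a_{\max}$ and then decelerates from $v_1$ back to $v_{\min}$ with constant acceleration $a_{\min}$), and finally accelerates from $v_{\min}$ to $v_{\max}$ with constant acceleration $a_{\max}$. Then the distance traveled to have $R(N)\ge R_{\text{designed}}$ is lower bounded by $$\frac{T_sR_{\text{designed}}\,v_{\min}}{|a_{\min}|a_{\max}}-\frac{(v_{\max}-v_{\min})v_{\min}}{|a_{\min}|}+\frac{v_{\max}^2-v_{\min}^2}{2a_{\max}}.$$ The bound is achieved in the limit as $v_1\to v_{\min}$. For this limit case, and for given $a_{\min}$, $a_{\max}$ and $v_{\min}$, the distance is minimized by taking $$v_{\max}=\frac{a_{\max}}{|a_{\min}|}\,v_{\min},$$ which gives the distance $$d^\star=\frac{T_sR_{\text{designed}}\,v_{\min}}{|a_{\min}|a_{\max}}-\frac{(|a_{\min}|-a_{\max})^2v_{\min}^2}{2|a_{\min}|^2a_{\max}}.$$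
   Context: The setting is the design of a vehicle's driving profile. $R(N)=\sum_{k=1}^N a(k)^2$ is the excitation energy of the sampled acceleration sequence $a(1),\dots,a(N)$ (sampling period $T_s$), and $R_{\text{designed}}>0$ is its prescribed lower bound. For the profile considered, $R(N)$ is computed without rounding segment durations to multiples of $T_s$: a segment of duration $t$ with constant acceleration $a$ contributes $\frac{t}{T_s}a^2$. The distance traveled is the time integral of the velocity over the whole profile ($M$ cycles plus the final acceleration). The number of cycles $M$ is determined by the requirement on $R(N)$.
   Formalization: Assumes v_min ≥ 0 (the lower bound fails for v_min < 0); attainment in the limit is stated when the final acceleration alone gives R(N) ≤ R_designed (else it fails, as M = 0); the optimal v_max is attained by profiles if also v_max ≥ v_min. *)

theory Defs
  imports "HOL-Analysis.Analysis"
begin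

text \<open>
  A driving profile is a list of segments (duration, constant acceleration).
\<close>

type_synonym segment = "real \<times> real"

definition ramp :: "real \<Rightarrow> real \<Rightarrow> real \<Rightarrow> segment" where
  "ramp v w a = ((w - v) / a, a)"

definition cycle_profile ::
  "real \<Rightarrow> real \<Rightarrow> real \<Rightarrow> real \<Rightarrow> real \<Rightarrow> nat \<Rightarrow> segment list" where
  "cycle_profile a\<^sub>m\<^sub>i\<^sub>n a\<^sub>m\<^sub>a\<^sub>x v\<^sub>m\<^sub>i\<^sub>n v\<^sub>m\<^sub>a\<^sub>x v\<^sub>1 M =
     concat (replicate M [ramp v\<^sub>m\<^sub>i\<^sub>n v\<^sub>1 a\<^sub>m\<^sub>a\<^sub>x, ramp v\<^sub>1 v\<^sub>m\<^sub>i\<^sub>n a\<^sub>m\<^sub>i\<^sub>n]) @ [ramp v\<^sub>m\<^sub>i\<^sub>n v\<^sub>m\<^sub>a\<^sub>x a\<^sub>m\<^sub>a\<^sub>x]"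

text \<open>
  The sum of the squared acceleration samples with sampling period \<open>T\<^sub>s\<close>, where a segment of
  duration \<open>t\<close> counts for \<open>t / T\<^sub>s\<close> samples (no rounding to an integer).
\<close>

definition excitation_energy :: "real \<Rightarrow> segment list \<Rightarrow> real" where
  "excitation_energy T\<^sub>s p = (\<Sum>(t, a)\<leftarrow>p. t / T\<^sub>s * a\<^sup>2)"

definition duration :: "segment list \<Rightarrow> real" where
  "duration p = (\<Sum>(t, a)\<leftarrow>p. t)"

text \<open>
  \<open>velocity v p t\<close> is the velocity at time \<open>t\<close> when \<open>p\<close> is driven from initial velocity \<open>v\<close>.
\<close>

fun velocity :: "real \<Rightarrow> segment list \<Rightarrow> real \<Rightarrow> real" where
  "velocity v [] t = v"
| "velocity v ((d, a) # p) t =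
     (if t \<le> d then v + a * t else velocity (v + a * d) p (t - d))"

definition distance :: "real \<Rightarrow> segment list \<Rightarrow> real" where
  "distance v p = integral {0..duration p} (velocity v p)"

text \<open>
  The number of cycles is the smallest one for which the prescribed excitation energy \<open>R\<close> is
  reached; it exists if \<open>v\<^sub>m\<^sub>i\<^sub>n < v\<^sub>1\<close>.
\<close>

definition required_cycles ::
  "real \<Rightarrow> real \<Rightarrow> real \<Rightarrow> real \<Rightarrow> real \<Rightarrow> real \<Rightarrow> real \<Rightarrow> nat" where
  "required_cycles T\<^sub>s R a\<^sub>m\<^sub>i\<^sub>n a\<^sub>m\<^sub>a\<^sub>x v\<^sub>m\<^sub>i\<^sub>n v\<^sub>m\<^sub>a\<^sub>x v\<^sub>1 =
     (LEAST M. excitation_energy T\<^sub>s (cycle_profile a\<^sub>m\<^sub>i\<^sub>n a\<^sub>m\<^sub>a\<^sub>x v\<^sub>m\<^sub>i\<^sub>n v\<^sub>m\<^sub>a\<^sub>x v\<^sub>1 M) \<ge> R)"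

definition travelled_distance ::
  "real \<Rightarrow> real \<Rightarrow> real \<Rightarrow> real \<Rightarrow> real \<Rightarrow> real \<Rightarrow> real \<Rightarrow> real" where
  "travelled_distance T\<^sub>s R a\<^sub>m\<^sub>i\<^sub>n a\<^sub>m\<^sub>a\<^sub>x v\<^sub>m\<^sub>i\<^sub>n v\<^sub>m\<^sub>a\<^sub>x v\<^sub>1 =
     distance v\<^sub>m\<^sub>i\<^sub>n (cycle_profile a\<^sub>m\<^sub>i\<^sub>n a\<^sub>m\<^sub>a\<^sub>x v\<^sub>m\<^sub>i\<^sub>n v\<^sub>m\<^sub>a\<^sub>x v\<^sub>1
       (required_cycles T\<^sub>s R a\<^sub>m\<^sub>i\<^sub>n a\<^sub>m\<^sub>a\<^sub>x v\<^sub>m\<^sub>i\<^sub>n v\<^sub>m\<^sub>a\<^sub>x v\<^sub>1))"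

definition distance_bound ::
  "real \<Rightarrow> real \<Rightarrow> real \<Rightarrow> real \<Rightarrow> real \<Rightarrow> real \<Rightarrow> real" where
  "distance_bound T\<^sub>s R a\<^sub>m\<^sub>i\<^sub>n a\<^sub>m\<^sub>a\<^sub>x v\<^sub>m\<^sub>i\<^sub>n v\<^sub>m\<^sub>a\<^sub>x =
     T\<^sub>s * R * v\<^sub>m\<^sub>i\<^sub>n / (\<bar>a\<^sub>m\<^sub>i\<^sub>n\<bar> * a\<^sub>m\<^sub>a\<^sub>x)
     - (v\<^sub>m\<^sub>a\<^sub>x - v\<^sub>m\<^sub>i\<^sub>n) * v\<^sub>m\<^sub>i\<^sub>n / \<bar>a\<^sub>m\<^sub>i\<^sub>n\<bar>
     + (v\<^sub>m\<^sub>a\<^sub>x\<^sup>2 - v\<^sub>m\<^sub>i\<^sub>n\<^sup>2) / (2 * a\<^sub>m\<^sub>a\<^sub>x)"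

end

theory Submission
  imports Defs
begin

text \<open>
  A ramp between two velocities contributes to \<open>R(N)\<close> in proportion to the change of velocity, and to
  the distance in proportion to the change of squared velocity. Put \<open>x = M (v\<^sub>1 - v\<^sub>m\<^sub>i\<^sub>n) (a\<^sub>m\<^sub>a\<^sub>x - a\<^sub>m\<^sub>i\<^sub>n)\<close>.
  The energy requirement says exactly \<open>x \<ge> T\<^sub>s R - (v\<^sub>m\<^sub>a\<^sub>x - v\<^sub>m\<^sub>i\<^sub>n) a\<^sub>m\<^sub>a\<^sub>x\<close>, while the cycles cover the
  distance \<open>x (v\<^sub>1 + v\<^sub>m\<^sub>i\<^sub>n) / (2 a\<^sub>m\<^sub>a\<^sub>x \<bar>a\<^sub>m\<^sub>i\<^sub>n\<bar>) \<ge> x v\<^sub>m\<^sub>i\<^sub>n / (a\<^sub>m\<^sub>a\<^sub>x \<bar>a\<^sub>m\<^sub>i\<^sub>n\<bar>)\<close>. For the least admissible \<open>M\<close>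
  the overshoot of \<open>x\<close> is at most one cycle, hence vanishes as \<open>v\<^sub>1 \<rightarrow> v\<^sub>m\<^sub>i\<^sub>n\<close>. The bound is a
  quadratic polynomial in \<open>v\<^sub>m\<^sub>a\<^sub>x\<close>, minimized by completing the square.
\<close>

section \<open>Energy and distance of a profile, segment by segment\<close>

lemma duration_Nil [simp]: "duration [] = 0"
  and duration_Cons [simp]: "duration ((t, a) # p) = t + duration p"
  by (simp_all add: duration_def)

lemma excitation_energy_Nil [simp]: "excitation_energy T [] = 0"
  and excitation_energy_Cons [simp]:
    "excitation_energy T ((t, a) # p) = t / T * a\<^sup>2 + excitation_energy T p"
  by (simp_all add: excitation_energy_def)

lemma duration_nonneg:
  assumes "\<And>t a. (t, a) \<in> set p \<Longrightarrow> 0 \<le> t"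
  shows "0 \<le> duration p"
  unfolding duration_def by (rule sum_list_nonneg) (use assms in auto)

text \<open>The interval splits at \<open>t\<close>: on the first piece the velocity is affine, on
  the second it is the velocity along \<open>p\<close> shifted by \<open>t\<close>. Using
  \<open>has_integral\<close> carries existence and value of the integral through the recursion
  together.\<close>

lemma has_integral_velocity_Cons:
  assumes t: "0 \<le> t" and p: "0 \<le> duration p"
    and int: "(velocity (v + a * t) p has_integral I) {0..duration p}"
  shows "(velocity v ((t, a) # p) has_integral (v * t + a * t\<^sup>2 / 2 + I))
           {0..duration ((t, a) # p)}"
proof (rule has_integral_combine[where c = t])
  have "((\<lambda>s. v + a * s) has_integral
          (v * t + a * t\<^sup>2 / 2) - (v * 0 + a * 0\<^sup>2 / 2)) {0..t}"
    by (rule fundamental_theorem_of_calculus)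
      (use t in \<open>auto intro!: derivative_eq_intros
        simp flip: has_real_derivative_iff_has_vector_derivative\<close>)
  then show "(velocity v ((t, a) # p) has_integral (v * t + a * t\<^sup>2 / 2)) {0..t}"
    by (subst has_integral_cong[where g = "\<lambda>s. v + a * s"]) auto
next
  have "((\<lambda>s. velocity (v + a * t) p (s - t)) has_integral I) {t..t + duration p}"
    using has_integral_shift_real_ivl[OF int, of "- t"]
    by (simp add: add.commute)
  then show "(velocity v ((t, a) # p) has_integral I) {t..duration ((t, a) # p)}"
    \<comment> \<open>At the breakpoint \<open>t\<close> itself \<open>velocity\<close> still takes
      its first branch, so agreement with the shifted function is claimed only off this single
      point.\<close>
    unfolding duration_Cons by (rule has_integral_spike_finite[of "{t}", rotated 2]) auto
qed (use t p in auto)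

text \<open>Needed to turn the recursion for \<open>has_integral\<close> into an equation for
  \<open>distance\<close>, since \<open>integral\<close> has a default value on non-integrable
  functions.\<close>

lemma velocity_integrable_on:
  assumes "\<And>t a. (t, a) \<in> set p \<Longrightarrow> 0 \<le> t"
  shows "velocity v p integrable_on {0..duration p}"
  using assms
proof (induction p arbitrary: v)
  case Nil
  show ?case using integrable_on_refl[of "\<lambda>_. v" 0] by simp
next
  case (Cons x p)
  obtain t a where x: "x = (t, a)" by force
  have "velocity (v + a * t) p integrable_on {0..duration p}"
    using Cons by auto
  moreover have "0 \<le> duration p"
    using Cons.prems by (intro duration_nonneg) auto
  ultimately show ?case
    using Cons.prems has_integral_velocity_Cons[of t p v a] unfolding x
    by (meson integrable_on_def list.set_intros(1))
qed

lemma distance_Nil [simp]: "distance v [] = 0"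
  by (simp add: distance_def)

lemma distance_Cons:
  assumes "0 \<le> t" and p: "\<And>t a. (t, a) \<in> set p \<Longrightarrow> 0 \<le> t"
  shows "distance v ((t, a) # p) = v * t + a * t\<^sup>2 / 2 + distance (v + a * t) p"
  unfolding distance_def
  by (intro integral_unique has_integral_velocity_Cons integrable_integral
        velocity_integrable_on duration_nonneg assms)

lemma distance_ramp_Cons:
  assumes "0 \<le> (w - v) / a" "a \<noteq> 0" and "\<And>t a. (t, a) \<in> set p \<Longrightarrow> 0 \<le> t"
  shows "distance v (ramp v w a # p) = (w\<^sup>2 - v\<^sup>2) / (2 * a) + distance w p"
proof -
  have "v * ((w - v) / a) + a * ((w - v) / a)\<^sup>2 / 2 = (w\<^sup>2 - v\<^sup>2) / (2 * a)"
    using assms(2) by (simp add: field_simps power2_eq_square)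
  then show ?thesis
    using assms by (simp add: ramp_def distance_Cons)
qed

lemma excitation_energy_ramp_Cons:
  assumes "a \<noteq> 0"
  shows "excitation_energy T (ramp v w a # p) = (w - v) * a / T + excitation_energy T p"
  using assms by (simp add: ramp_def power2_eq_square)

section \<open>Closed forms for the cycle profile\<close>

lemma cycle_profile_0 [simp]: "cycle_profile b a v w v1 0 = [ramp v w a]"
  and cycle_profile_Suc [simp]: "cycle_profile b a v w v1 (Suc M) =
    ramp v v1 a # ramp v1 v b # cycle_profile b a v w v1 M"
  by (simp_all add: cycle_profile_def)

lemma cycle_profile_durations_nonneg:
  assumes "b < 0" "0 < a" "v \<le> v1" "v \<le> w" "(t, c) \<in> set (cycle_profile b a v w v1 M)"
  shows "0 \<le> t"
  using assms(5)
  by (induction M) (use assms(1-4) in \<open>auto simp: ramp_def divide_nonpos_neg\<close>)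

lemma excitation_energy_cycle_profile:
  assumes "b < 0" "0 < a"
  shows "excitation_energy T (cycle_profile b a v w v1 M) =
    (M * ((v1 - v) * (a - b)) + (w - v) * a) / T"
  using assms
  by (induction M) (auto simp: excitation_energy_ramp_Cons add_divide_distrib diff_divide_distrib
      algebra_simps)

text \<open>The factor \<open>M * ((v1 - v) * (a - b))\<close> is kept together because it is the
  quantity that the energy constrains.\<close>

lemma distance_cycle_profile:
  assumes "b < 0" "0 < a" "v \<le> v1" "v \<le> w"
  shows "distance v (cycle_profile b a v w v1 M) =
    M * ((v1 - v) * (a - b)) * (v1 + v) / (2 * (\<bar>b\<bar> * a)) + (w\<^sup>2 - v\<^sup>2) / (2 * a)"
proof (induction M)
  case 0
  have "distance v (ramp v w a # []) = (w\<^sup>2 - v\<^sup>2) / (2 * a) + distance w []"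
    using assms by (intro distance_ramp_Cons) auto
  then show ?case by simp
next
  case (Suc M)
  note nonneg = cycle_profile_durations_nonneg[OF assms]
  have "distance v (cycle_profile b a v w v1 (Suc M)) =
    (v1\<^sup>2 - v\<^sup>2) / (2 * a) + distance v1 (ramp v1 v b # cycle_profile b a v w v1 M)"
    unfolding cycle_profile_Suc
  proof (rule distance_ramp_Cons)
    fix t c
    assume "(t, c) \<in> set (ramp v1 v b # cycle_profile b a v w v1 M)"
    then show "0 \<le> t"
      using assms nonneg[of t c M] by (auto simp: ramp_def divide_nonpos_neg)
  qed (use assms in auto)
  also have "distance v1 (ramp v1 v b # cycle_profile b a v w v1 M) =
    (v\<^sup>2 - v1\<^sup>2) / (2 * b) + distance v (cycle_profile b a v w v1 M)"
    using assms by (intro distance_ramp_Cons) (auto simp: divide_nonpos_neg dest: nonneg)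
  \<comment> \<open>Since \<open>b < 0\<close>, we have
    \<open>1 / a - 1 / b = (a - b) / (\<bar>b\<bar> * a)\<close>.\<close>
  also have "(v1\<^sup>2 - v\<^sup>2) / (2 * a) + ((v\<^sup>2 - v1\<^sup>2) / (2 * b) + d) =
      ((v1 - v) * (a - b)) * (v1 + v) / (2 * (\<bar>b\<bar> * a)) + d" for d
    using assms by (simp add: field_simps power2_eq_square)
  finally show ?case
    unfolding Suc cycle_profile_Suc by (simp add: distrib_right add_divide_distrib)
qed

section \<open>The lower bound on the distance\<close>

lemma energy_requirement_iff:
  assumes "0 < T" "b < 0" "0 < a"
  shows "R \<le> excitation_energy T (cycle_profile b a v w v1 M) \<longleftrightarrow>
    T * R - (w - v) * a \<le> M * ((v1 - v) * (a - b))"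
  using assms by (simp add: excitation_energy_cycle_profile field_simps)

text \<open>This is the closed form of the distance with \<open>v1\<close> replaced by
  \<open>v\<close> and the cycle term by its energy threshold; \<open>v + v\<close> is left
  unsimplified to match \<open>v1 + v\<close>.\<close>

lemma distance_bound_eq:
  assumes "b < 0" "0 < a"
  shows "distance_bound T R b a v w =
    (T * R - (w - v) * a) * (v + v) / (2 * (\<bar>b\<bar> * a)) + (w\<^sup>2 - v\<^sup>2) / (2 * a)"
  using assms by (simp add: distance_bound_def field_simps)

lemma distance_bound_le_distance:
  assumes "0 < T" "b < 0" "0 < a" "0 \<le> v" "v \<le> v1" "v \<le> w"
    and R: "R \<le> excitation_energy T (cycle_profile b a v w v1 M)"
  shows "distance_bound T R b a v w \<le> distance v (cycle_profile b a v w v1 M)"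
proof -
  let ?x = "M * ((v1 - v) * (a - b))"
  have "(T * R - (w - v) * a) * (v + v) \<le> ?x * (v + v)"
    using R assms by (intro mult_right_mono) (auto simp: energy_requirement_iff)
  \<comment> \<open>The previous inequality needs \<open>0 \<le> v\<close>; this one needs
    \<open>?x\<close> to be nonnegative, which follows from \<open>v \<le> v1\<close> and
    \<open>b < a\<close>.\<close>
  also have "\<dots> \<le> ?x * (v1 + v)"
    using assms by (intro mult_left_mono) auto
  finally show ?thesis
    unfolding distance_bound_eq[OF assms(2,3)] distance_cycle_profile[OF assms(2,3,5,6)]
    using assms by (intro add_right_mono divide_right_mono) (auto simp: mult_le_0_iff)
qed

section \<open>The limit of vanishing cycle amplitude\<close>

lemma Least_multiple_bounds:
  fixes K c :: real
  assumes "0 < c"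
  defines "M \<equiv> LEAST n. K \<le> real n * c"
  shows "max K 0 \<le> real M * c" "real M * c \<le> max K 0 + c"
proof -
  obtain n where "K \<le> real n * c"
    using ex_less_of_nat_mult[OF assms(1)] less_imp_le by blast
  then have "K \<le> real M * c"
    unfolding M_def by (rule LeastI)
  then show "max K 0 \<le> real M * c"
    using assms(1) by simp
  \<comment> \<open>By minimality the predecessor of \<open>M\<close> misses \<open>K\<close>, so
    the overshoot is below one step. For \<open>M = 0\<close> there is no predecessor, and the
    right-hand side is nonnegative thanks to the maximum.\<close>
  show "real M * c \<le> max K 0 + c"
  proof (cases M)
    case 0
    then show ?thesis using assms(1) by simp
  next
    case (Suc m)
    then have "\<not> K \<le> real m * c"
      unfolding M_def using not_less_Least by (metis lessI)
    then show ?thesis using Suc by (simp add: algebra_simps)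
  qed
qed

text \<open>
  The maximum covers the degenerate case in which the final acceleration alone exceeds the required
  energy, so that no cycles are driven.
\<close>

lemma travelled_distance_tendsto:
  assumes "0 < T" "b < 0" "0 < a" "v \<le> w"
  shows "((\<lambda>v1. travelled_distance T R b a v w v1) \<longlongrightarrow>
    max (T * R - (w - v) * a) 0 * (v + v) / (2 * (\<bar>b\<bar> * a)) + (w\<^sup>2 - v\<^sup>2) / (2 * a))
    (at_right v)"
proof -
  define K where "K = T * R - (w - v) * a"
  define x where "x = (\<lambda>v1. required_cycles T R b a v w v1 * ((v1 - v) * (a - b)))"
  have bounds: "max K 0 \<le> x v1" "x v1 \<le> max K 0 + (v1 - v) * (a - b)" if "v < v1" for v1
    using Least_multiple_bounds[of "(v1 - v) * (a - b)" K] that assms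
    by (simp_all add: x_def required_cycles_def energy_requirement_iff K_def)
  have upper: "((\<lambda>v1. max K 0 + (v1 - v) * (a - b)) \<longlongrightarrow> max K 0 + (v - v) * (a - b)) (at_right v)"
    by (intro tendsto_intros)
  have x: "(x \<longlongrightarrow> max K 0) (at_right v)"
  proof (rule tendsto_sandwich[OF _ _ tendsto_const])
    show "\<forall>\<^sub>F v1 in at_right v. max K 0 \<le> x v1"
      by (rule eventually_at_rightI[of v "v + 1"]) (use bounds in auto)
    show "\<forall>\<^sub>F v1 in at_right v. x v1 \<le> max K 0 + (v1 - v) * (a - b)"
      by (rule eventually_at_rightI[of v "v + 1"]) (use bounds in auto)
  qed (use upper in simp)
  have "((\<lambda>v1. x v1 * (v1 + v) / (2 * (\<bar>b\<bar> * a)) + (w\<^sup>2 - v\<^sup>2) / (2 * a)) \<longlongrightarrow>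
    max K 0 * (v + v) / (2 * (\<bar>b\<bar> * a)) + (w\<^sup>2 - v\<^sup>2) / (2 * a)) (at_right v)"
    using assms by (intro tendsto_intros x) auto
  \<comment> \<open>The closed form holds to the right of \<open>v\<close>, which suffices for the
    one-sided filter; the endpoint \<open>v + 1\<close> is arbitrary.\<close>
  moreover have "\<forall>\<^sub>F v1 in at_right v. x v1 * (v1 + v) / (2 * (\<bar>b\<bar> * a)) + (w\<^sup>2 - v\<^sup>2) / (2 * a) =
      travelled_distance T R b a v w v1"
    using assms by (intro eventually_at_rightI[of v "v + 1"])
      (auto simp: x_def travelled_distance_def distance_cycle_profile)
  ultimately show ?thesis
    unfolding K_def by (rule Lim_transform_eventually)
qed

text \<open>If the final ramp does not exceed the required energy, the threshold is nonnegative and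
  the maximum with 0 disappears.\<close>

lemma travelled_distance_tendsto_distance_bound:
  assumes "0 < T" "b < 0" "0 < a" "v \<le> w" "excitation_energy T [ramp v w a] \<le> R"
  shows "((\<lambda>v1. travelled_distance T R b a v w v1) \<longlongrightarrow> distance_bound T R b a v w) (at_right v)"
proof -
  have "0 \<le> T * R - (w - v) * a"
    using assms by (simp add: excitation_energy_ramp_Cons field_simps)
  then show ?thesis
    using travelled_distance_tendsto[OF assms(1-4), of R] assms(2,3)
    by (simp add: distance_bound_eq)
qed

section \<open>Minimization over the final velocity\<close>

lemma distance_bound_square:
  assumes "b < 0" "0 < a"
  shows "distance_bound T R b a v w =
    T * R * v / (\<bar>b\<bar> * a) - (\<bar>b\<bar> - a)\<^sup>2 * v\<^sup>2 / (2 * \<bar>b\<bar>\<^sup>2 * a) + (w - a / \<bar>b\<bar> * v)\<^sup>2 / (2 * a)"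
  using assms by (simp add: distance_bound_def field_simps power2_eq_square)

theorem theorem2:
  fixes T\<^sub>s R a\<^sub>m\<^sub>i\<^sub>n a\<^sub>m\<^sub>a\<^sub>x v\<^sub>m\<^sub>i\<^sub>n :: real
  assumes "T\<^sub>s > 0" and "R > 0" and "a\<^sub>m\<^sub>i\<^sub>n < 0" and "0 < a\<^sub>m\<^sub>a\<^sub>x" and "0 \<le> v\<^sub>m\<^sub>i\<^sub>n"
  shows
    "(\<forall>v\<^sub>m\<^sub>a\<^sub>x v\<^sub>1 M. v\<^sub>m\<^sub>i\<^sub>n < v\<^sub>1 \<and> v\<^sub>1 \<le> v\<^sub>m\<^sub>a\<^sub>x \<and>
        excitation_energy T\<^sub>s (cycle_profile a\<^sub>m\<^sub>i\<^sub>n a\<^sub>m\<^sub>a\<^sub>x v\<^sub>m\<^sub>i\<^sub>n v\<^sub>m\<^sub>a\<^sub>x v\<^sub>1 M) \<ge> R \<longrightarrow>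
        distance v\<^sub>m\<^sub>i\<^sub>n (cycle_profile a\<^sub>m\<^sub>i\<^sub>n a\<^sub>m\<^sub>a\<^sub>x v\<^sub>m\<^sub>i\<^sub>n v\<^sub>m\<^sub>a\<^sub>x v\<^sub>1 M)
          \<ge> distance_bound T\<^sub>s R a\<^sub>m\<^sub>i\<^sub>n a\<^sub>m\<^sub>a\<^sub>x v\<^sub>m\<^sub>i\<^sub>n v\<^sub>m\<^sub>a\<^sub>x)
     \<and>
     (\<forall>v\<^sub>m\<^sub>a\<^sub>x. v\<^sub>m\<^sub>i\<^sub>n \<le> v\<^sub>m\<^sub>a\<^sub>x \<and> excitation_energy T\<^sub>s [ramp v\<^sub>m\<^sub>i\<^sub>n v\<^sub>m\<^sub>a\<^sub>x a\<^sub>m\<^sub>a\<^sub>x] \<le> R \<longrightarrow>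
        ((\<lambda>v\<^sub>1. travelled_distance T\<^sub>s R a\<^sub>m\<^sub>i\<^sub>n a\<^sub>m\<^sub>a\<^sub>x v\<^sub>m\<^sub>i\<^sub>n v\<^sub>m\<^sub>a\<^sub>x v\<^sub>1)
           \<longlongrightarrow> distance_bound T\<^sub>s R a\<^sub>m\<^sub>i\<^sub>n a\<^sub>m\<^sub>a\<^sub>x v\<^sub>m\<^sub>i\<^sub>n v\<^sub>m\<^sub>a\<^sub>x) (at_right v\<^sub>m\<^sub>i\<^sub>n))
     \<and>
     (let v\<^sub>o\<^sub>p\<^sub>t = a\<^sub>m\<^sub>a\<^sub>x / \<bar>a\<^sub>m\<^sub>i\<^sub>n\<bar> * v\<^sub>m\<^sub>i\<^sub>n;
          d = T\<^sub>s * R * v\<^sub>m\<^sub>i\<^sub>n / (\<bar>a\<^sub>m\<^sub>i\<^sub>n\<bar> * a\<^sub>m\<^sub>a\<^sub>x)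
              - (\<bar>a\<^sub>m\<^sub>i\<^sub>n\<bar> - a\<^sub>m\<^sub>a\<^sub>x)\<^sup>2 * v\<^sub>m\<^sub>i\<^sub>n\<^sup>2 / (2 * \<bar>a\<^sub>m\<^sub>i\<^sub>n\<bar>\<^sup>2 * a\<^sub>m\<^sub>a\<^sub>x)
      in
        distance_bound T\<^sub>s R a\<^sub>m\<^sub>i\<^sub>n a\<^sub>m\<^sub>a\<^sub>x v\<^sub>m\<^sub>i\<^sub>n v\<^sub>o\<^sub>p\<^sub>t = d \<and>
        (\<forall>w. distance_bound T\<^sub>s R a\<^sub>m\<^sub>i\<^sub>n a\<^sub>m\<^sub>a\<^sub>x v\<^sub>m\<^sub>i\<^sub>n v\<^sub>o\<^sub>p\<^sub>t
               \<le> distance_bound T\<^sub>s R a\<^sub>m\<^sub>i\<^sub>n a\<^sub>m\<^sub>a\<^sub>x v\<^sub>m\<^sub>i\<^sub>n w) \<and>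
        (v\<^sub>m\<^sub>i\<^sub>n \<le> v\<^sub>o\<^sub>p\<^sub>t \<and> excitation_energy T\<^sub>s [ramp v\<^sub>m\<^sub>i\<^sub>n v\<^sub>o\<^sub>p\<^sub>t a\<^sub>m\<^sub>a\<^sub>x] \<le> R \<longrightarrow>
           ((\<lambda>v\<^sub>1. travelled_distance T\<^sub>s R a\<^sub>m\<^sub>i\<^sub>n a\<^sub>m\<^sub>a\<^sub>x v\<^sub>m\<^sub>i\<^sub>n v\<^sub>o\<^sub>p\<^sub>t v\<^sub>1) \<longlongrightarrow> d) (at_right v\<^sub>m\<^sub>i\<^sub>n)) \<and>
        (\<forall>w\<ge>v\<^sub>m\<^sub>i\<^sub>n. \<exists>L\<ge>d.
           ((\<lambda>v\<^sub>1. travelled_distance T\<^sub>s R a\<^sub>m\<^sub>i\<^sub>n a\<^sub>m\<^sub>a\<^sub>x v\<^sub>m\<^sub>i\<^sub>n w v\<^sub>1) \<longlongrightarrow> L) (at_right v\<^sub>m\<^sub>i\<^sub>n)))"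
proof -
  note lim = travelled_distance_tendsto_distance_bound[OF assms(1,3,4)]
  define v\<^sub>o\<^sub>p\<^sub>t where "v\<^sub>o\<^sub>p\<^sub>t = a\<^sub>m\<^sub>a\<^sub>x / \<bar>a\<^sub>m\<^sub>i\<^sub>n\<bar> * v\<^sub>m\<^sub>i\<^sub>n"
  define d where "d = T\<^sub>s * R * v\<^sub>m\<^sub>i\<^sub>n / (\<bar>a\<^sub>m\<^sub>i\<^sub>n\<bar> * a\<^sub>m\<^sub>a\<^sub>x)
    - (\<bar>a\<^sub>m\<^sub>i\<^sub>n\<bar> - a\<^sub>m\<^sub>a\<^sub>x)\<^sup>2 * v\<^sub>m\<^sub>i\<^sub>n\<^sup>2 / (2 * \<bar>a\<^sub>m\<^sub>i\<^sub>n\<bar>\<^sup>2 * a\<^sub>m\<^sub>a\<^sub>x)"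
  let ?B = "distance_bound T\<^sub>s R a\<^sub>m\<^sub>i\<^sub>n a\<^sub>m\<^sub>a\<^sub>x v\<^sub>m\<^sub>i\<^sub>n"
  have B: "?B w = d + (w - v\<^sub>o\<^sub>p\<^sub>t)\<^sup>2 / (2 * a\<^sub>m\<^sub>a\<^sub>x)" for w
    using distance_bound_square[OF assms(3,4)] by (simp add: d_def v\<^sub>o\<^sub>p\<^sub>t_def)
  have opt: "?B v\<^sub>o\<^sub>p\<^sub>t = d"
    by (simp add: B)
  have min: "d \<le> ?B w" for w
    using assms(4) by (simp add: B)
  \<comment> \<open>The witness is the general limit with the truncated threshold, because a large
    \<open>w\<close> may leave no cycles to drive. Truncation only raises the value, as
    \<open>0 \<le> v\<^sub>m\<^sub>i\<^sub>n\<close>, so \<open>L\<close> stays above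
    \<open>?B w\<close> and hence above \<open>d\<close>.\<close>
  have "\<exists>L\<ge>d. ((\<lambda>v\<^sub>1. travelled_distance T\<^sub>s R a\<^sub>m\<^sub>i\<^sub>n a\<^sub>m\<^sub>a\<^sub>x v\<^sub>m\<^sub>i\<^sub>n w v\<^sub>1) \<longlongrightarrow> L) (at_right v\<^sub>m\<^sub>i\<^sub>n)"
    if "v\<^sub>m\<^sub>i\<^sub>n \<le> w" for w
  proof (intro exI conjI)
    show "((\<lambda>v\<^sub>1. travelled_distance T\<^sub>s R a\<^sub>m\<^sub>i\<^sub>n a\<^sub>m\<^sub>a\<^sub>x v\<^sub>m\<^sub>i\<^sub>n w v\<^sub>1) \<longlongrightarrow>
      max (T\<^sub>s * R - (w - v\<^sub>m\<^sub>i\<^sub>n) * a\<^sub>m\<^sub>a\<^sub>x) 0 * (v\<^sub>m\<^sub>i\<^sub>n + v\<^sub>m\<^sub>i\<^sub>n) / (2 * (\<bar>a\<^sub>m\<^sub>i\<^sub>n\<bar> * a\<^sub>m\<^sub>a\<^sub>x))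
        + (w\<^sup>2 - v\<^sub>m\<^sub>i\<^sub>n\<^sup>2) / (2 * a\<^sub>m\<^sub>a\<^sub>x)) (at_right v\<^sub>m\<^sub>i\<^sub>n)"
      by (rule travelled_distance_tendsto[OF assms(1,3,4) that])
    have "d \<le> ?B w"
      by (rule min)
    also have "\<dots> \<le> max (T\<^sub>s * R - (w - v\<^sub>m\<^sub>i\<^sub>n) * a\<^sub>m\<^sub>a\<^sub>x) 0 * (v\<^sub>m\<^sub>i\<^sub>n + v\<^sub>m\<^sub>i\<^sub>n) / (2 * (\<bar>a\<^sub>m\<^sub>i\<^sub>n\<bar> * a\<^sub>m\<^sub>a\<^sub>x))
        + (w\<^sup>2 - v\<^sub>m\<^sub>i\<^sub>n\<^sup>2) / (2 * a\<^sub>m\<^sub>a\<^sub>x)"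
      unfolding distance_bound_eq[OF assms(3,4)]
      using assms by (intro add_right_mono divide_right_mono mult_right_mono)
        (auto simp: mult_le_0_iff)
    finally show "d \<le> \<dots>" .
  qed
  moreover have "?B v\<^sub>m\<^sub>a\<^sub>x \<le> distance v\<^sub>m\<^sub>i\<^sub>n (cycle_profile a\<^sub>m\<^sub>i\<^sub>n a\<^sub>m\<^sub>a\<^sub>x v\<^sub>m\<^sub>i\<^sub>n v\<^sub>m\<^sub>a\<^sub>x v\<^sub>1 M)"
    if "v\<^sub>m\<^sub>i\<^sub>n < v\<^sub>1" "v\<^sub>1 \<le> v\<^sub>m\<^sub>a\<^sub>x"
      "R \<le> excitation_energy T\<^sub>s (cycle_profile a\<^sub>m\<^sub>i\<^sub>n a\<^sub>m\<^sub>a\<^sub>x v\<^sub>m\<^sub>i\<^sub>n v\<^sub>m\<^sub>a\<^sub>x v\<^sub>1 M)" for v\<^sub>m\<^sub>a\<^sub>x v\<^sub>1 M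
    using that assms by (intro distance_bound_le_distance) auto
  ultimately show ?thesis
    unfolding Let_def v\<^sub>o\<^sub>p\<^sub>t_def[symmetric] d_def[symmetric]
    using lim lim[of v\<^sub>m\<^sub>i\<^sub>n v\<^sub>o\<^sub>p\<^sub>t R] min by (auto simp: opt)
qed

end
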